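(* Let $\|\cdot\|_K$ be a norm on $\mathbb{R}^n$ with open unit ball $K$. Let $w_0:\mathbb{R}^n\to\mathbb{R}_+$ be a $1$-homogeneous measurable function with $\int_K w_0(x)\,dx<\infty$. Let $\varphi:(0,\infty)\to\mathbb{R}_+$ be a non-increasing function, non-integrable at the origin, integrable at infinity, and such that $\log\varphi:(0,\infty)\to[-\infty,\infty)$ is convex. Set $$\mu=w_0(x/\|x\|_K)\,\|x\|_K^{1-n}\,\varphi(\|x\|_K)\,dx .$$ Then, denoting $\Phi(t):=\int_t^\infty\varphi(s)\,ds$ and $I:=\varphi\circ\Phi^{-1}$, the following isoperimetric inequality holds: $$\mu^-_{\|\cdot\|_K}(C)\ \ge\ I(\mu(C))$$ for any Borel set $C\subset\mathbb{R}^n$ with $\mu(C)<\infty$, and with equality for $C=\mathbb{R}^n\setminus tK$, $t>0$. In other words, complements of homothetic copies of $K$ are isoperimetric minimizers for $(\mathbb{R}^n,\|\cdot\|_K,\mu)$.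
   Context: Norms need not be symmetric: only positive homogeneity $\|\lambda x\|=\lambda\|x\|$ for $\lambda\ge0$ is required in place of full homogeneity. $K=\{x:\|x\|_K<1\}$. $w_0$ is $1$-homogeneous if $w_0(\lambda x)=\lambda w_0(x)$ for all $x$ and all $\lambda>0$. Inner Minkowski boundary measure: $\mu^-_{\|\cdot\|_K}(C)=\liminf_{\epsilon\to0^+}\frac{\mu((A+\epsilon K)\setminus A)}{\epsilon}$ with $A=\mathbb{R}^n\setminus C$, where $A+\epsilon K=\{a+\epsilon k: a\in A,\ k\in K\}$ is the Minkowski sum. Isoperimetric minimizers are sets of given measure on which the sharp lower bound on the boundary measure, as a function of the measure of the set, is attained. Conventions: $\varphi(\infty)=0$; $\Phi^{-1}(0)=\infty$ if the support of $\Phi$ is not compact, and $\Phi^{-1}(0)=z$ if that support is $[0,z]$ with $z<\infty$.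
   Formalization: The displayed inequality and equality fail unless m=(n+1)∫_K w_0 dx equals 1 (n=1, w_0=|x|, φ=t^{-2} is a counterexample); they are proved with m·I(μ(C)/m) in place of I(μ(C)) for every w_0, and as displayed when m=1. The minimizer claim is proved for every w_0. *)

theory Defs
  imports "HOL-Analysis.Analysis"
begin

text \<open>A norm in the sense used here is only positively homogeneous; it need not be symmetric.\<close>

definition nonsym_norm :: "('a::real_vector \<Rightarrow> real) \<Rightarrow> bool" where
  "nonsym_norm N \<longleftrightarrow>
     (\<forall>x. 0 \<le> N x) \<and> (\<forall>x. N x = 0 \<longleftrightarrow> x = 0) \<and>
     (\<forall>x. \<forall>r\<ge>0. N (r *\<^sub>R x) = r * N x) \<and>
     (\<forall>x y. N (x + y) \<le> N x + N y)"

definition unit_ball :: "('a \<Rightarrow> real) \<Rightarrow> 'a set" where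
  "unit_ball N = {x. N x < 1}"

definition one_homogeneous :: "('a::real_vector \<Rightarrow> real) \<Rightarrow> bool" where
  "one_homogeneous w \<longleftrightarrow> (\<forall>x. \<forall>r>0. w (r *\<^sub>R x) = r * w x)"

definition elog :: "real \<Rightarrow> ereal" where
  "elog x = (if x = 0 then -\<infinity> else ereal (ln x))"

text \<open>Convexity of \<open>log \<phi>\<close>, as a function from the positive half-line to the extended reals
  without \<open>\<infinity>\<close>; no indeterminate sums can occur.\<close>

definition log_convex_pos :: "(real \<Rightarrow> real) \<Rightarrow> bool" where
  "log_convex_pos \<phi> \<longleftrightarrow>
     (\<forall>x>0. \<forall>y>0. \<forall>u\<in>{0<..<1}.
        elog (\<phi> ((1 - u) * x + u * y)) \<le> ereal (1 - u) * elog (\<phi> x) + ereal u * elog (\<phi> y))"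

definition integrable_at_origin :: "(real \<Rightarrow> real) \<Rightarrow> bool" where
  "integrable_at_origin \<phi> \<longleftrightarrow> (\<exists>r>0. set_integrable lborel {0<..<r} \<phi>)"

definition integrable_at_infinity :: "(real \<Rightarrow> real) \<Rightarrow> bool" where
  "integrable_at_infinity \<phi> \<longleftrightarrow> (\<exists>r>0. set_integrable lborel {r<..} \<phi>)"

definition Tail :: "(real \<Rightarrow> real) \<Rightarrow> real \<Rightarrow> real" where
  "Tail \<phi> t = set_lebesgue_integral lborel {t<..} \<phi>"

text \<open>The inverse of \<open>Tail \<phi>\<close> on the positive half-line. At \<open>0\<close> it is \<open>\<infinity>\<close> if the
  support of \<open>Tail \<phi>\<close> is not compact in \<open>[0,\<infinity>)\<close>, and the right endpoint \<open>z\<close> if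
  the support is \<open>[0,z]\<close>; the supremum covers both cases.\<close>

definition Tail_inv :: "(real \<Rightarrow> real) \<Rightarrow> real \<Rightarrow> ereal" where
  "Tail_inv \<phi> v =
     (if v = 0 then Sup (ereal ` {t. 0 < t \<and> Tail \<phi> t \<noteq> 0})
      else ereal (the_inv_into {0<..} (Tail \<phi>) v))"

definition at_ext :: "(real \<Rightarrow> real) \<Rightarrow> ereal \<Rightarrow> real" where
  "at_ext \<phi> t = (if t = \<infinity> then 0 else \<phi> (real_of_ereal t))"

definition iso_profile :: "(real \<Rightarrow> real) \<Rightarrow> real \<Rightarrow> real" where
  "iso_profile \<phi> = at_ext \<phi> \<circ> Tail_inv \<phi>"

text \<open>The value of the density at the origin is irrelevant. The base measure is the complete
  Lebesgue measure because the weight is only assumed Lebesgue measurable.\<close>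

definition polar_measure ::
    "('a::euclidean_space \<Rightarrow> real) \<Rightarrow> ('a \<Rightarrow> real) \<Rightarrow> (real \<Rightarrow> real) \<Rightarrow> 'a measure" where
  "polar_measure N w \<phi> = density lebesgue
     (\<lambda>x. ennreal (w (x /\<^sub>R N x) * N x powi (1 - int DIM('a)) * \<phi> (N x)))"

text \<open>The total mass of the weight on the unit sphere of \<open>N\<close>, with respect to the cone measure
  \<open>\<sigma>\<close> for which \<open>dx = r^(n-1) dr d\<sigma>\<close>. For a 1-homogeneous weight, the
  integral over the unit ball is this mass times \<open>\<integral>\<^sub>0\<^sup>1 r^n dr = 1 / (n + 1)\<close>.
  The complement of the ball of radius \<open>t\<close> then has \<open>polar_measure\<close> equal to this mass times
  \<open>Tail \<phi> t\<close>, so the profile of \<open>polar_measure\<close> is \<open>iso_profile \<phi>\<close> only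
  when the mass is 1.\<close>

definition sphere_mass :: "('a::euclidean_space \<Rightarrow> real) \<Rightarrow> ('a \<Rightarrow> real) \<Rightarrow> real" where
  "sphere_mass N w = (real DIM('a) + 1) * set_lebesgue_integral lebesgue (unit_ball N) w"

definition minkowski_sum :: "'a::plus set \<Rightarrow> 'a set \<Rightarrow> 'a set" where
  "minkowski_sum A B = {a + b | a b. a \<in> A \<and> b \<in> B}"

definition inner_boundary_measure ::
    "('a::real_vector \<Rightarrow> real) \<Rightarrow> 'a measure \<Rightarrow> 'a set \<Rightarrow> ennreal" where
  "inner_boundary_measure N \<mu> C =
     Liminf (at_right (0::real))
       (\<lambda>\<epsilon>. emeasure \<mu> (minkowski_sum (- C) ((\<lambda>k. \<epsilon> *\<^sub>R k) ` unit_ball N) - (- C)) / ennreal \<epsilon>)"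

definition isoperimetric_minimizer ::
    "('a::real_normed_vector \<Rightarrow> real) \<Rightarrow> 'a measure \<Rightarrow> 'a set \<Rightarrow> bool" where
  "isoperimetric_minimizer N \<mu> C \<longleftrightarrow>
     C \<in> sets borel \<and> emeasure \<mu> C < \<infinity> \<and>
     (\<forall>D\<in>sets borel. emeasure \<mu> D = emeasure \<mu> C \<longrightarrow>
        inner_boundary_measure N \<mu> C \<le> inner_boundary_measure N \<mu> D)"

end

theory Submission
  imports Defs
begin

text \<open>In polar coordinates \<open>x = r u\<close> the measure is the product of a finite cone measure \<open>d\<sigma>(u)\<close>
  of mass \<open>m\<close> and \<open>\<phi>(r) dr\<close>. Let \<open>A\<close> be the complement of \<open>C\<close>. Since \<open>\<phi>\<close> is not integrable at the
  origin, \<open>A\<close> accumulates at the origin, so a point \<open>r u\<close> of \<open>C\<close> outside \<open>A + \<epsilon>K\<close> has \<open>r > \<delta>\<close> and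
  \<open>(r - \<delta>) u \<in> C\<close> for every \<open>\<delta> < \<epsilon>\<close>. Shifting \<open>r\<close> by \<open>\<delta>\<close>, the measure of what remains of \<open>C\<close> is at
  most the integral over \<open>C\<close> of \<open>\<phi>(r + \<delta>) / \<phi>(r)\<close>. By log-convexity this ratio is nondecreasing in
  \<open>r\<close>, so among sets of measure \<open>m \<Phi>(t)\<close> the integral is largest for the complement of \<open>tK\<close>, where it
  equals \<open>m \<Phi>(t + \<delta>)\<close>. Hence \<open>C\<close> loses at least \<open>m (\<Phi>(t) - \<Phi>(t + \<delta>))\<close>.\<close>

section \<open>Polar decomposition of a homogeneous weight\<close>

text \<open>The weight is only Lebesgue measurable, so scaling is done for the complete measure; it
  is the diagonal affine map with all coefficients equal to \<open>c\<close>.\<close>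

lemma nn_integral_lebesgue_scaleR:
  fixes f :: "'a::euclidean_space \<Rightarrow> ennreal"
  assumes [measurable]: "f \<in> borel_measurable lebesgue" and c: "c \<noteq> 0"
  shows "(\<integral>\<^sup>+x. f x \<partial>lebesgue) = ennreal (\<bar>c\<bar> ^ DIM('a)) * (\<integral>\<^sup>+x. f (c *\<^sub>R x) \<partial>lebesgue)"
proof -
  have eq: "(\<lambda>x::'a. \<Sum>j\<in>Basis. (c * (x \<bullet> j)) *\<^sub>R j) = (*\<^sub>R) c"
    unfolding scaleR_scaleR[symmetric] scaleR_sum_right[symmetric] euclidean_representation ..
  have "(\<integral>\<^sup>+x. f x \<partial>lebesgue) =
      (\<integral>\<^sup>+x. f x \<partial>density (distr lebesgue lebesgue ((*\<^sub>R) c)) (\<lambda>_. ennreal (\<bar>c\<bar> ^ DIM('a))))"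
    using lebesgue_affine_euclidean[of "\<lambda>_::'a. c" 0] c by (simp add: eq)
  also have "\<dots> = ennreal (\<bar>c\<bar> ^ DIM('a)) * (\<integral>\<^sup>+x. f (c *\<^sub>R x) \<partial>lebesgue)"
    by (simp add: nn_integral_density nn_integral_distr nn_integral_cmult)
  finally show ?thesis .
qed

text \<open>Used with \<open>n = DIM('a)\<close>: the Jacobian contributes
  \<open>r ^ (n - 1)\<close> and the 1-homogeneous weight the remaining factor
  \<open>r\<close>.\<close>

definition radial_measure :: "nat \<Rightarrow> real measure" where
  "radial_measure n = density lborel (\<lambda>r. ennreal (indicator {0<..} r * r ^ n))"

lemma sets_radial_measure [simp, measurable_cong]: "sets (radial_measure n) = sets borel"
  and space_radial_measure [simp]: "space (radial_measure n) = UNIV"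
  by (simp_all add: radial_measure_def)

lemma emeasure_radial_measure_lessThan:
  "emeasure (radial_measure n) {..<b} = ennreal (max b 0 ^ (n + 1) / (real n + 1))"
proof -
  \<comment> \<open>The endpoints are null, so the interval may be closed for the fundamental
    theorem; \<open>max b 0\<close> makes it degenerate when \<open>b \<le> 0\<close>.\<close>
  have "AE r in lborel. r \<noteq> 0 \<and> r \<noteq> b"
    using AE_lborel_singleton[of 0] AE_lborel_singleton[of b] by eventually_elim simp
  then have ae: "AE r in lborel. ennreal (indicator {0<..} r * r ^ n) * indicator {..<b} r =
      ennreal (r ^ n) * indicator {0 .. max b 0} r"
    by eventually_elim (auto simp: indicator_def)
  have "emeasure (radial_measure n) {..<b} =
      (\<integral>\<^sup>+r. ennreal (indicator {0<..} r * r ^ n) * indicator {..<b} r \<partial>lborel)"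
    unfolding radial_measure_def by (rule emeasure_density) measurable
  also have "\<dots> = (\<integral>\<^sup>+r. ennreal (r ^ n) * indicator {0 .. max b 0} r \<partial>lborel)"
    using ae by (rule nn_integral_cong_AE)
  also have "\<dots> = ennreal (max b 0 ^ (n + 1) / (real n + 1) - 0 ^ (n + 1) / (real n + 1))"
  proof (rule nn_integral_FTC_Icc)
    show "DERIV (\<lambda>r. r ^ (n + 1) / (real n + 1)) x :> x ^ n" for x
      using DERIV_cdivide[OF DERIV_pow[of "n + 1" x UNIV], of "real n + 1"]
      by (simp add: add.commute)
  qed auto
  finally show ?thesis by simp
qed

lemma sigma_finite_radial_measure: "sigma_finite_measure (radial_measure n)"
proof
  show "\<exists>A. countable A \<and> A \<subseteq> sets (radial_measure n) \<and> \<Union> A = space (radial_measure n) \<and>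
      (\<forall>a\<in>A. emeasure (radial_measure n) a \<noteq> \<infinity>)"
    by (rule exI[of _ "range (\<lambda>i::nat. {..<real i})"])
       (auto simp: emeasure_radial_measure_lessThan reals_Archimedean2)
qed

section \<open>Cone measure and splitting into direction and radius\<close>

locale homogeneous_weight =
  fixes N w :: "'a::euclidean_space \<Rightarrow> real"
  assumes norm: "nonsym_norm N"
    and w_nonneg: "0 \<le> w x"
    and w_homogeneous: "one_homogeneous w"
    and w_measurable [measurable]: "w \<in> borel_measurable lebesgue"
    and w_finite: "(\<integral>\<^sup>+x\<in>unit_ball N. ennreal (w x) \<partial>lebesgue) < \<infinity>"
begin

lemma N_nonneg [simp]: "0 \<le> N x"
  and N_eq_0_iff [simp]: "N x = 0 \<longleftrightarrow> x = 0"
  and N_scaleR: "0 \<le> r \<Longrightarrow> N (r *\<^sub>R x) = r * N x"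
  and N_triangle: "N (x + y) \<le> N x + N y"
  using norm by (auto simp: nonsym_norm_def)

lemma N_pos_iff [simp]: "0 < N x \<longleftrightarrow> x \<noteq> 0"
  using N_nonneg[of x] N_eq_0_iff[of x] by linarith

lemma w_scaleR: "0 < r \<Longrightarrow> w (r *\<^sub>R x) = r * w x"
  using w_homogeneous by (auto simp: one_homogeneous_def)

text \<open>Serves to obtain continuity, hence Borel measurability, of \<open>N\<close>.\<close>

lemma convex_on_N: "convex_on UNIV N"
proof (rule convex_onI)
  fix t x y assume "0 < (t::real)" "t < 1"
  then show "N ((1 - t) *\<^sub>R x + t *\<^sub>R y) \<le> (1 - t) * N x + t * N y"
    using N_triangle[of "(1 - t) *\<^sub>R x" "t *\<^sub>R y"] by (simp add: N_scaleR)
qed simp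

lemma continuous_N: "continuous_on S N"
  using convex_on_continuous[OF open_UNIV convex_on_N] continuous_on_subset by blast

lemma N_borel [measurable]: "N \<in> borel_measurable borel"
  by (intro borel_measurable_continuous_onI continuous_N)

lemma lebesgue_compose_borel:
  "g \<in> borel \<rightarrow>\<^sub>M M \<Longrightarrow> g \<in> lebesgue \<rightarrow>\<^sub>M M"
  by (rule measurable_completion) simp

lemma N_lebesgue [measurable]: "N \<in> borel_measurable lebesgue"
  by (intro lebesgue_compose_borel N_borel)

lemma AE_lebesgue_nonzero: "AE x in lebesgue. x \<noteq> (0::'a)"
proof (rule AE_I)
  show "emeasure lebesgue {0::'a} = 0" by simp
qed auto

lemma N_dir: "x \<noteq> 0 \<Longrightarrow> N (x /\<^sub>R N x) = 1"
  by (simp add: N_scaleR)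

lemma unit_ball_borel [measurable]: "unit_ball N \<in> sets borel"
  unfolding unit_ball_def by measurable

lemma unit_ball_lebesgue [measurable]: "unit_ball N \<in> sets lebesgue"
  by (rule sets_completionI_sets) simp

definition weighted :: "'a measure" where
  "weighted = density lebesgue (\<lambda>x. ennreal (w x))"

text \<open>The weighted cone measure on the unit sphere of \<open>N\<close>, realized as the image
  of \<open>w\<close> on the unit ball under taking directions. The factor
  \<open>DIM('a) + 1\<close> cancels the integral of \<open>r ^ DIM('a)\<close> over the unit
  interval.\<close>

definition cone_measure :: "'a measure" where
  "cone_measure = distr (density lebesgue
     (\<lambda>x. ennreal (real DIM('a) + 1) * (ennreal (w x) * indicator (unit_ball N) x))) borel (\<lambda>x. x /\<^sub>R N x)"

lemma sets_cone_measure [simp, measurable_cong]: "sets cone_measure = sets borel"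
  and space_cone_measure [simp]: "space cone_measure = UNIV"
  by (simp_all add: cone_measure_def)

lemma dir_scaleR: "0 < r \<Longrightarrow> (r *\<^sub>R x) /\<^sub>R N (r *\<^sub>R x) = x /\<^sub>R N x"
  by (simp add: N_scaleR field_simps)

lemma dir_borel [measurable]: "(\<lambda>x. x /\<^sub>R N x) \<in> borel \<rightarrow>\<^sub>M borel"
  by measurable

lemma dir_lebesgue [measurable]: "(\<lambda>x. x /\<^sub>R N x) \<in> lebesgue \<rightarrow>\<^sub>M borel"
  by (intro lebesgue_compose_borel dir_borel)

lemma emeasure_cone_measure:
  assumes [measurable]: "S \<in> sets borel"
  shows "emeasure cone_measure S = ennreal (real DIM('a) + 1) *
    (\<integral>\<^sup>+x. ennreal (w x) * indicator (unit_ball N) x * indicator S (x /\<^sub>R N x) \<partial>lebesgue)"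
proof -
  have *: "(\<lambda>x. x /\<^sub>R N x) -` S \<in> sets lebesgue"
    using measurable_sets[OF dir_lebesgue assms] by simp
  let ?g = "\<lambda>x. ennreal (real DIM('a) + 1) * (ennreal (w x) * indicator (unit_ball N) x)"
  have "emeasure cone_measure S = emeasure (density lebesgue ?g) ((\<lambda>x. x /\<^sub>R N x) -` S)"
    unfolding cone_measure_def by (subst emeasure_distr) simp_all
  also have "\<dots> = (\<integral>\<^sup>+x. ?g x * indicator ((\<lambda>x. x /\<^sub>R N x) -` S) x \<partial>lebesgue)"
    by (rule emeasure_density) (use * in measurable)
  also have "\<dots> = (\<integral>\<^sup>+x. ennreal (real DIM('a) + 1) *
      (ennreal (w x) * indicator (unit_ball N) x * indicator ((\<lambda>x. x /\<^sub>R N x) -` S) x) \<partial>lebesgue)"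
    by (simp only: mult.assoc)
  also have "\<dots> = ennreal (real DIM('a) + 1) *
    (\<integral>\<^sup>+x. ennreal (w x) * indicator (unit_ball N) x * indicator ((\<lambda>x. x /\<^sub>R N x) -` S) x \<partial>lebesgue)"
    by (rule nn_integral_cmult) (use * in measurable)
  finally show ?thesis by (simp add: indicator_def)
qed

lemma emeasure_cone_measure_UNIV: "emeasure cone_measure UNIV = ennreal (sphere_mass N w)"
  and sphere_mass_nonneg: "0 \<le> sphere_mass N w"
proof -
  have fin: "(\<integral>\<^sup>+x. ennreal (w x * indicator (unit_ball N) x) \<partial>lebesgue) < \<infinity>"
    using w_finite by (simp add: ennreal_mult' ennreal_indicator w_nonneg)
  have int: "integrable lebesgue (\<lambda>x. w x * indicator (unit_ball N) x)"
    by (intro integrableI_nonneg fin) (auto simp: w_nonneg)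
  show "0 \<le> sphere_mass N w"
    unfolding sphere_mass_def set_lebesgue_integral_def
    by (intro mult_nonneg_nonneg Bochner_Integration.integral_nonneg) (auto simp: w_nonneg)
  have "(\<integral>\<^sup>+x. ennreal (w x * indicator (unit_ball N) x) \<partial>lebesgue) =
     ennreal (set_lebesgue_integral lebesgue (unit_ball N) w)"
    unfolding set_lebesgue_integral_def
    by (subst nn_integral_eq_integral[OF int]) (auto simp: w_nonneg mult.commute)
  then show "emeasure cone_measure UNIV = ennreal (sphere_mass N w)"
    by (subst emeasure_cone_measure)
       (auto simp: sphere_mass_def ennreal_mult' w_nonneg ennreal_indicator)
qed

lemma finite_measure_cone_measure: "finite_measure cone_measure"
  by (rule finite_measureI) (simp add: emeasure_cone_measure_UNIV)

text \<open>Only the origin has a direction off the sphere (\<open>0 /\<^sub>R N 0 = 0\<close>), and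
  it is a null set.\<close>

lemma AE_cone_measure: "AE u in cone_measure. N u = 1"
proof -
  let ?D = "density lebesgue
    (\<lambda>x. ennreal (real DIM('a) + 1) * (ennreal (w x) * indicator (unit_ball N) x))"
  have "AE x in lebesgue. N (x /\<^sub>R N x) = 1"
    using AE_lebesgue_nonzero by eventually_elim (rule N_dir)
  then have "AE x in ?D. N (x /\<^sub>R N x) = 1"
    by (subst AE_density) (measurable, auto)
  moreover have "(\<lambda>x. x /\<^sub>R N x) \<in> ?D \<rightarrow>\<^sub>M borel"
    using dir_lebesgue by simp
  moreover have "{u \<in> space borel. N u = 1} \<in> sets borel"
    by measurable
  ultimately show ?thesis
    unfolding cone_measure_def by (subst AE_distr_iff)
qed

text \<open>Scaling by \<open>b\<close> fixes directions; Lebesgue measure contributes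
  \<open>b ^ DIM('a)\<close> and homogeneity of \<open>w\<close> one more factor
  \<open>b\<close>.\<close>

lemma weighted_cone_scale:
  assumes [measurable]: "S \<in> sets borel" and b: "0 < b"
  shows "(\<integral>\<^sup>+x. ennreal (w x) * indicator {..<b} (N x) * indicator S (x /\<^sub>R N x) \<partial>lebesgue) =
    ennreal (b ^ (DIM('a) + 1)) *
    (\<integral>\<^sup>+x. ennreal (w x) * indicator (unit_ball N) x * indicator S (x /\<^sub>R N x) \<partial>lebesgue)"
proof -
  have [measurable]: "(\<lambda>x. indicator S (x /\<^sub>R N x) :: ennreal) \<in> borel_measurable lebesgue"
    by (intro lebesgue_compose_borel) measurable
  have [measurable]: "(\<lambda>x. indicator {..<b} (N x) :: ennreal) \<in> borel_measurable lebesgue"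
    by (intro lebesgue_compose_borel) measurable
  let ?f = "\<lambda>x. ennreal (w x) * indicator {..<b} (N x) * indicator S (x /\<^sub>R N x)"
  let ?g = "\<lambda>x. ennreal (w x) * indicator (unit_ball N) x * indicator S (x /\<^sub>R N x)"
  have w: "ennreal (w (b *\<^sub>R x)) = ennreal b * ennreal (w x)" for x
    using b by (simp add: w_scaleR ennreal_mult' w_nonneg)
  have i: "indicator {..<b} (N (b *\<^sub>R x)) = (indicator (unit_ball N) x :: ennreal)" for x
    using b by (simp add: N_scaleR unit_ball_def indicator_def)
  have eq: "?f (b *\<^sub>R x) = ennreal b * ?g x" for x
    unfolding dir_scaleR[OF b] w i by (simp only: mult.assoc)
  have "(\<integral>\<^sup>+x. ?f x \<partial>lebesgue) = ennreal (\<bar>b\<bar> ^ DIM('a)) * (\<integral>\<^sup>+x. ?f (b *\<^sub>R x) \<partial>lebesgue)"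
    by (rule nn_integral_lebesgue_scaleR) (use b in \<open>measurable, auto\<close>)
  also have "(\<integral>\<^sup>+x. ?f (b *\<^sub>R x) \<partial>lebesgue) = ennreal b * (\<integral>\<^sup>+x. ?g x \<partial>lebesgue)"
    unfolding eq by (rule nn_integral_cmult) measurable
  also have "ennreal (\<bar>b\<bar> ^ DIM('a)) * (ennreal b * (\<integral>\<^sup>+x. ?g x \<partial>lebesgue)) =
      ennreal (b ^ (DIM('a) + 1)) * (\<integral>\<^sup>+x. ?g x \<partial>lebesgue)"
  proof -
    have "ennreal (\<bar>b\<bar> ^ DIM('a)) * ennreal b = ennreal (b ^ (DIM('a) + 1))"
      using b by (subst ennreal_mult[symmetric]) (simp_all add: mult.commute)
    then show ?thesis by (simp only: mult.assoc[symmetric])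
  qed
  finally show ?thesis .
qed

text \<open>For a fixed set of directions, scaling makes the mass of norm below \<open>b\<close>
  proportional to \<open>b ^ (DIM('a) + 1)\<close>. The half-lines form an intersection-stable
  generator with finite masses, so this determines the whole radial law.\<close>

lemma cone_measure_times_radial:
  assumes [measurable]: "S \<in> sets borel"
  shows "distr (density weighted (\<lambda>x. indicator S (x /\<^sub>R N x))) borel N =
    scale_measure (emeasure cone_measure S) (radial_measure DIM('a))" (is "?M = ?M'")
proof (rule measure_eqI_generator_eq[where E="range lessThan" and \<Omega>=UNIV and A="\<lambda>i::nat. {..<real i}"])
  have [measurable]: "(\<lambda>x. indicator S (x /\<^sub>R N x) :: ennreal) \<in> borel_measurable lebesgue"
    by (intro lebesgue_compose_borel) measurable
  have [measurable_cong]: "sets weighted = sets lebesgue" by (simp add: weighted_def)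
  have borel: "sets borel = sigma_sets UNIV (range (lessThan :: real \<Rightarrow> _))"
    by (subst borel_eq_lessThan) (simp add: eucl_lessThan)
  show "sets ?M = sigma_sets UNIV (range lessThan)" "sets ?M' = sigma_sets UNIV (range lessThan)"
    by (simp_all add: borel)
  show "Int_stable (range (lessThan :: real \<Rightarrow> _))"
    
  proof (clarsimp simp: Int_stable_def)
    fix a b :: real
    have "{..<a} \<inter> {..<b} = {..<min a b}" by auto
    then show "{..<a} \<inter> {..<b} \<in> range lessThan" by blast
  qed
  have fin: "emeasure cone_measure S \<noteq> \<infinity>"
    using finite_measure.emeasure_finite[OF finite_measure_cone_measure] by simp
  have M: "emeasure ?M {..<b} = 
    (\<integral>\<^sup>+x. ennreal (w x) * indicator {..<b} (N x) * indicator S (x /\<^sub>R N x) \<partial>lebesgue)" for b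
  proof -
    have *: "N -` {..<b} \<in> sets lebesgue"
      using measurable_sets[OF N_lebesgue, of "{..<b}"] by simp
    have [measurable]: "(\<lambda>x. indicator {..<b} (N x) :: ennreal) \<in> borel_measurable lebesgue"
      by (intro lebesgue_compose_borel) measurable
    have "emeasure ?M {..<b} = emeasure (density weighted (\<lambda>x. indicator S (x /\<^sub>R N x))) (N -` {..<b})"
      using N_lebesgue by (subst emeasure_distr) (simp_all add: weighted_def)
    also have "\<dots> = (\<integral>\<^sup>+x. indicator S (x /\<^sub>R N x) * indicator (N -` {..<b}) x \<partial>weighted)"
      by (rule emeasure_density) (simp_all add: weighted_def *)
    also have "\<dots> = (\<integral>\<^sup>+x. indicator S (x /\<^sub>R N x) * indicator {..<b} (N x) \<partial>weighted)"
      by (simp add: indicator_def)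
    also have "\<dots> = (\<integral>\<^sup>+x. ennreal (w x) * (indicator S (x /\<^sub>R N x) * indicator {..<b} (N x)) \<partial>lebesgue)"
      unfolding weighted_def by (rule nn_integral_density) measurable
    also have "\<dots> = (\<integral>\<^sup>+x. ennreal (w x) * indicator {..<b} (N x) * indicator S (x /\<^sub>R N x) \<partial>lebesgue)"
      by (simp only: ac_simps)
    finally show ?thesis .
  qed
  have eq: "emeasure ?M {..<b} = emeasure ?M' {..<b}" for b
  proof (cases "0 < b")
    case True
    let ?c = "\<integral>\<^sup>+x. ennreal (w x) * indicator (unit_ball N) x * indicator S (x /\<^sub>R N x) \<partial>lebesgue"
    have "emeasure ?M' {..<b} = ennreal (real DIM('a) + 1) * ?c * ennreal (b ^ (DIM('a) + 1) / (real DIM('a) + 1))"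
      using True by (simp add: emeasure_cone_measure[OF assms] emeasure_radial_measure_lessThan)
    also have "\<dots> = (ennreal (real DIM('a) + 1) * ennreal (b ^ (DIM('a) + 1) / (real DIM('a) + 1))) * ?c"
      by (simp only: ac_simps)
    also have "ennreal (real DIM('a) + 1) * ennreal (b ^ (DIM('a) + 1) / (real DIM('a) + 1)) = ennreal (b ^ (DIM('a) + 1))"
      using True by (subst ennreal_mult[symmetric]) auto
    finally show ?thesis
      unfolding M weighted_cone_scale[OF assms True] by (rule sym)
  next
    case False
    then have "indicator {..<b} (N x) = (0::ennreal)" for x
      using N_nonneg[of x] by (auto simp: indicator_def simp del: N_nonneg)
    then show ?thesis using False
      by (simp add: M emeasure_radial_measure_lessThan)
  qed
  then show "emeasure ?M X = emeasure ?M' X" if "X \<in> range lessThan" for X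
    using that by auto
  show "emeasure ?M {..<real i} \<noteq> \<infinity>" for i
    using fin by (simp add: eq emeasure_radial_measure_lessThan ennreal_mult_eq_top_iff)
qed (auto simp: reals_Archimedean2)

text \<open>With sigma-finite factors, rectangles \<open>A \<times> B\<close> suffice, and each one
  is \<open>cone_measure_times_radial\<close> for the directions \<open>A\<close>, evaluated at
  \<open>B\<close>.\<close>

lemma polar_decomposition:
  "cone_measure \<Otimes>\<^sub>M (radial_measure DIM('a)) = distr weighted (borel \<Otimes>\<^sub>M borel) (\<lambda>x. (x /\<^sub>R N x, N x))"
proof (rule pair_measure_eqI)
  have [measurable_cong]: "sets weighted = sets lebesgue" by (simp add: weighted_def)
  show "sigma_finite_measure cone_measure"
    using finite_measure_cone_measure by (rule finite_measure.axioms)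
  show "sigma_finite_measure (radial_measure DIM('a))" by (rule sigma_finite_radial_measure)
  show "sets (cone_measure \<Otimes>\<^sub>M (radial_measure DIM('a))) =
      sets (distr weighted (borel \<Otimes>\<^sub>M borel) (\<lambda>x. (x /\<^sub>R N x, N x)))"
    by (simp add: sets_pair_measure_cong[of cone_measure borel _ borel])
  fix A B assume "A \<in> sets cone_measure" "B \<in> sets (radial_measure DIM('a))"
  then have [measurable]: "A \<in> sets borel" "B \<in> sets borel" by simp_all
  have [measurable]: "(\<lambda>x. indicator A (x /\<^sub>R N x) :: ennreal) \<in> borel_measurable lebesgue"
    by (intro lebesgue_compose_borel) measurable
  have *: "N -` B \<in> sets lebesgue" "(\<lambda>x. x /\<^sub>R N x) -` A \<in> sets lebesgue"
    using measurable_sets[OF N_lebesgue, of B] measurable_sets[OF dir_lebesgue, of A] by auto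
  have vimage: "(\<lambda>x. (x /\<^sub>R N x, N x)) -` (A \<times> B) = (\<lambda>x. x /\<^sub>R N x) -` A \<inter> N -` B" by auto
  have meas: "(\<lambda>x. (x /\<^sub>R N x, N x)) \<in> lebesgue \<rightarrow>\<^sub>M borel \<Otimes>\<^sub>M borel"
    by (intro lebesgue_compose_borel) measurable
  have "emeasure cone_measure A * emeasure (radial_measure DIM('a)) B =
      emeasure (distr (density weighted (\<lambda>x. indicator A (x /\<^sub>R N x))) borel N) B"
    by (simp add: cone_measure_times_radial)
  also have "\<dots> = emeasure (density weighted (\<lambda>x. indicator A (x /\<^sub>R N x))) (N -` B)"
    by (subst emeasure_distr) (auto simp: weighted_def)
  also have "\<dots> = (\<integral>\<^sup>+x. indicator A (x /\<^sub>R N x) * indicator (N -` B) x \<partial>weighted)"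
    by (rule emeasure_density) (auto simp: weighted_def *)
  also have "\<dots> = (\<integral>\<^sup>+x. indicator ((\<lambda>x. (x /\<^sub>R N x, N x)) -` (A \<times> B)) x \<partial>weighted)"
    by (intro nn_integral_cong) (auto split: split_indicator)
  also have "\<dots> = emeasure weighted ((\<lambda>x. (x /\<^sub>R N x, N x)) -` (A \<times> B))"
    by (intro nn_integral_indicator) (auto simp: weighted_def vimage *)
  also have "\<dots> = emeasure (distr weighted (borel \<Otimes>\<^sub>M borel) (\<lambda>x. (x /\<^sub>R N x, N x))) (A \<times> B)"
    using meas by (subst emeasure_distr) (auto simp: weighted_def)
  finally show "emeasure cone_measure A * emeasure (radial_measure DIM('a)) B =
    emeasure (distr weighted (borel \<Otimes>\<^sub>M borel) (\<lambda>x. (x /\<^sub>R N x, N x))) (A \<times> B)" .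
qed

end

section \<open>Log-convex radial densities\<close>

locale log_convex_density =
  fixes \<phi> :: "real \<Rightarrow> real"
  assumes nonneg: "0 < t \<Longrightarrow> 0 \<le> \<phi> t"
    and antimono: "antimono_on {0<..} \<phi>"
    and not_integrable: "\<not> integrable_at_origin \<phi>"
    and integrable: "integrable_at_infinity \<phi>"
    and log_convex: "log_convex_pos \<phi>"
begin

lemma le: "0 < s \<Longrightarrow> s \<le> t \<Longrightarrow> \<phi> t \<le> \<phi> s"
  using antimono by (auto simp: monotone_on_def)

lemma elog_convex:
  "0 < x \<Longrightarrow> 0 < y \<Longrightarrow> 0 < u \<Longrightarrow> u < 1 \<Longrightarrow>
    elog (\<phi> ((1 - u) * x + u * y)) \<le> ereal (1 - u) * elog (\<phi> x) + ereal u * elog (\<phi> y)"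
  using log_convex by (simp add: log_convex_pos_def)

text \<open>By log-convexity a zero of \<open>\<phi>\<close> propagates to the left of itself, and a density vanishing
  near the origin would be integrable there.\<close>

lemma pos:
  assumes t: "0 < t"
  shows "0 < \<phi> t"
proof (rule ccontr)
  assume "\<not> 0 < \<phi> t"
  then have 0: "\<phi> t = 0" using nonneg[OF t] by simp
  have zero: "\<phi> s = 0" if s: "0 < s" "s < t" for s
  proof -
    \<comment> \<open>\<open>?u\<close> is solved from the requirement that \<open>s\<close> be the
      convex combination of the zero \<open>t\<close> and the smaller point \<open>s / 2\<close>.
      Both weights are positive and \<open>elog\<close> never equals \<open>\<infinity>\<close>, so
      the value \<open>- \<infinity>\<close> at \<open>t\<close> absorbs the other term.\<close>
    let ?y = "s / 2" let ?u = "(t - s) / (t - ?y)"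
    have u: "0 < ?u" "?u < 1" using s by (auto simp: field_simps)
    have d: "t - ?y > 0" using s by simp
    have "(1 - u) * t + u * y = t - u * (t - y)" for u y :: real
      by (simp add: algebra_simps)
    then have "(1 - ?u) * t + ?u * ?y = t - ?u * (t - ?y)" .
    also have "\<dots> = s" using d by simp
    finally have eq: "(1 - ?u) * t + ?u * ?y = s" .
    have "elog (\<phi> s) \<le> ereal (1 - ?u) * (- \<infinity>) + ereal ?u * elog (\<phi> ?y)"
      using elog_convex[of t ?y ?u] t s u 0 unfolding eq by (simp add: elog_def)
    also have "ereal (1 - ?u) * (- \<infinity>) = - \<infinity>"
    proof -
      have "ereal c * (- \<infinity>) = - \<infinity>" if "0 < c" for c
        using that by simp
      then show ?thesis by this (use u in linarith)
    qed
    also have "- \<infinity> + ereal ?u * elog (\<phi> ?y) = - \<infinity>"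
    proof -
      have "- \<infinity> + ereal c * elog x = - \<infinity>" if "0 < c" for c x
        using that by (simp add: elog_def)
      then show ?thesis by this (use u in linarith)
    qed
    finally show ?thesis by (auto simp: elog_def split: if_splits)
  qed
  have "set_integrable lborel {0<..<t} \<phi>"
    unfolding set_integrable_def
    by (rule Bochner_Integration.integrable_cong[THEN iffD2, OF refl _ integrable_zero])
       (auto simp: zero indicator_def)
  then show False using not_integrable t by (auto simp: integrable_at_origin_def)
qed

lemma ln_convex:
  assumes "0 < x" "0 < y" "0 < u" "u < 1"
  shows "ln (\<phi> ((1 - u) * x + u * y)) \<le> (1 - u) * ln (\<phi> x) + u * ln (\<phi> y)"
proof -
  have "0 < (1 - u) * x + u * y" using assms by (simp add: add_pos_pos)
  then show ?thesis
    using elog_convex[OF assms] pos[of x] pos[of y] pos[of "(1 - u) * x + u * y"] assms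
    by (simp add: elog_def)
qed

lemma convex_on_ln: "convex_on {0<..} (\<lambda>t. ln (\<phi> t))"
  by (rule convex_onI) (auto simp: ln_convex)

text \<open>A finite convex function on an open interval is continuous; apply this to
  \<open>ln \<phi>\<close>.\<close>

lemma continuous: "continuous_on {0<..} \<phi>"
proof -
  have "continuous_on {0<..} (\<lambda>t. exp (ln (\<phi> t)))"
    by (intro continuous_on_exp convex_on_continuous convex_on_ln) simp
  then show ?thesis
    by (rule continuous_on_eq) (simp add: pos)
qed

text \<open>Of the points \<open>s\<close>, \<open>s + d\<close>, \<open>t\<close>,
  \<open>t + d\<close>, the inner two are convex combinations of the outer two \<open>s\<close> and
  \<open>t + d\<close> with exchanged weights. Adding both convexity inequalities for
  \<open>ln \<phi>\<close> cancels the weights.\<close>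

lemma shift_ratio_mono:
  assumes s: "0 < s" "s \<le> t" and d: "0 < d"
  shows "\<phi> (s + d) * \<phi> t \<le> \<phi> (t + d) * \<phi> s"
proof (cases "s = t")
  case False
  define L where "L = t - s + d"
  define u where "u = d / L"
  have L: "0 < L" "d < L" using False s d by (auto simp: L_def)
  have u: "0 < u" "u < 1" using L d by (auto simp: u_def)
  have uL: "u * L = d" using L by (simp add: u_def)
  have 1: "(1 - u) * s + u * (t + d) = s + d"
    using uL by (simp add: L_def algebra_simps)
  have 2: "(1 - u) * (t + d) + u * s = t"
    using uL by (simp add: L_def algebra_simps)
  have "ln (\<phi> (s + d)) + ln (\<phi> t) \<le> ln (\<phi> (t + d)) + ln (\<phi> s)"
    using ln_convex[of s "t + d" u] ln_convex[of "t + d" s u] s d u unfolding 1 2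
    by (simp add: algebra_simps)
  then have "ln (\<phi> (s + d) * \<phi> t) \<le> ln (\<phi> (t + d) * \<phi> s)"
    using s d pos[of "s + d"] pos[of t] pos[of "t + d"] pos[of s] by (simp add: ln_mult)
  then show ?thesis
    using s d pos[of "s + d"] pos[of t] pos[of "t + d"] pos[of s] by (subst (asm) ln_le_cancel_iff) auto
qed (simp add: mult.commute)

text \<open>\<open>\<phi>\<close> is arbitrary off the positive half-line; its extension by 0 is a
  Borel density, so radial integrals can run over all of \<open>lborel\<close>.\<close>

definition \<psi> :: "real \<Rightarrow> real" where
  "\<psi> r = indicator {0<..} r * \<phi> r"

lemma \<psi>_nonneg: "0 \<le> \<psi> r"
  by (auto simp: \<psi>_def indicator_def nonneg)

lemma \<psi>_pos: "0 < r \<Longrightarrow> \<psi> r = \<phi> r"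
  by (simp add: \<psi>_def)

lemma \<psi>_borel [measurable]: "\<psi> \<in> borel_measurable borel"
  using borel_measurable_continuous_on_indicator[OF _ continuous] by (simp add: \<psi>_def[abs_def])

section \<open>The tail function: monotonicity, continuity and range\<close>

lemma set_integrable_tail:
  assumes t: "0 < t"
  shows "set_integrable lborel {t<..} \<phi>"
proof -
  obtain r where r: "0 < r" "set_integrable lborel {r<..} \<phi>"
    using integrable by (auto simp: integrable_at_infinity_def)
  \<comment> \<open>Integrability at infinity supplies only some radius \<open>r\<close>; a gap
    between \<open>t\<close> and \<open>r\<close> is compact, and \<open>\<phi>\<close> is
    continuous on it.\<close>
  have "set_integrable lborel {t..max r t} \<phi>"
    by (rule borel_integrable_atLeastAtMost')
       (use t in \<open>auto intro: continuous_on_subset[OF continuous]\<close>)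
  then have "set_integrable lborel ({t..max r t} \<union> {r<..}) \<phi>"
    using r(2) by (intro set_integrable_Un) auto
  then show ?thesis
    by (rule set_integrable_subset) auto
qed

text \<open>Monotonicity bounds \<open>\<phi>\<close> by its endpoint values. The lower estimate
  drives the inequality for all sets, the upper one its equality case.\<close>

lemma Tail_diff:
  assumes t: "0 < t" and d: "0 \<le> d"
  shows "d * \<phi> (t + d) \<le> Tail \<phi> t - Tail \<phi> (t + d)" "Tail \<phi> t - Tail \<phi> (t + d) \<le> d * \<phi> t"
proof -
  have int: "set_integrable lborel {t<..t + d} \<phi>"
    by (rule set_integrable_subset[OF set_integrable_tail[OF t]]) auto
  have un: "{t<..} = {t<..t + d} \<union> {t + d<..}" using d by auto
  have eq: "Tail \<phi> t - Tail \<phi> (t + d) = (LINT x:{t<..t + d}|lborel. \<phi> x)"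
    unfolding Tail_def by (subst un, subst set_integral_Un)
      (use int set_integrable_tail[of "t + d"] t d in auto)
  have const: "set_integrable lborel {t<..t + d} (\<lambda>_. c)"
      "(LINT x:{t<..t + d}|lborel. c) = d * c" for c :: real
    using d by (auto simp: set_integrable_def set_lebesgue_integral_def)
  have "(LINT x:{t<..t + d}|lborel. \<phi> (t + d)) \<le> (LINT x:{t<..t + d}|lborel. \<phi> x)"
    by (rule set_integral_mono[OF const(1) int]) (use t in \<open>auto intro: le\<close>)
  then show "d * \<phi> (t + d) \<le> Tail \<phi> t - Tail \<phi> (t + d)"
    by (simp only: eq const)
  have "(LINT x:{t<..t + d}|lborel. \<phi> x) \<le> (LINT x:{t<..t + d}|lborel. \<phi> t)"
    by (rule set_integral_mono[OF int const(1)]) (use t in \<open>auto intro: le\<close>)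
  then show "Tail \<phi> t - Tail \<phi> (t + d) \<le> d * \<phi> t"
    by (simp only: eq const)
qed

lemma Tail_strict_antimono:
  assumes "0 < s" "s < t"
  shows "Tail \<phi> t < Tail \<phi> s"
proof -
  have "0 < (t - s) * \<phi> t" using assms pos[of t] by simp
  then show ?thesis using Tail_diff(1)[of s "t - s"] assms by simp
qed

lemma inj_on_Tail: "inj_on (Tail \<phi>) {0<..}"
  by (rule linorder_inj_onI) (auto dest: Tail_strict_antimono)

lemma Tail_nonneg: "0 < t \<Longrightarrow> 0 \<le> Tail \<phi> t"
  unfolding Tail_def set_lebesgue_integral_def
  by (rule Bochner_Integration.integral_nonneg) (auto simp: indicator_def nonneg)

lemma Tail_pos: "0 < t \<Longrightarrow> 0 < Tail \<phi> t"
  using Tail_strict_antimono[of t "t + 1"] Tail_nonneg[of "t + 1"] by simp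

lemma continuous_Tail:
  assumes a: "0 < a"
  shows "continuous_on {a..b} (Tail \<phi>)"
proof (rule lipschitz_on_continuous_on)
  have *: "Tail \<phi> x - Tail \<phi> y \<le> \<phi> a * (y - x)" "Tail \<phi> y \<le> Tail \<phi> x" if "a \<le> x" "x \<le> y" for x y
  proof -
    have "Tail \<phi> x - Tail \<phi> y \<le> (y - x) * \<phi> x"
      using Tail_diff(2)[of x "y - x"] that a by simp
    also have "\<dots> \<le> (y - x) * \<phi> a"
      using that a by (intro mult_left_mono le) auto
    finally show "Tail \<phi> x - Tail \<phi> y \<le> \<phi> a * (y - x)" by (simp add: mult.commute)
    show "Tail \<phi> y \<le> Tail \<phi> x"
      using Tail_strict_antimono[of x y] that a by (cases "x = y") auto
  qed
  show "(\<phi> a)-lipschitz_on {a..b} (Tail \<phi>)"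
  proof (rule lipschitz_on_leI)
    show "dist (Tail \<phi> x) (Tail \<phi> y) \<le> \<phi> a * dist x y"
      if "x \<in> {a..b}" "y \<in> {a..b}" "x \<le> y" for x y
      using *[of x y] that by (simp add: dist_real_def)
  qed (use nonneg a in auto)
qed

lemma nn_integral_tail:
  assumes t: "0 < t"
  shows "(\<integral>\<^sup>+r. ennreal (\<psi> r) * indicator {t<..} r \<partial>lborel) = ennreal (Tail \<phi> t)"
proof -
  have "(\<integral>\<^sup>+r. ennreal (\<psi> r) * indicator {t<..} r \<partial>lborel) =
      (\<integral>\<^sup>+r. ennreal (indicator {t<..} r *\<^sub>R \<phi> r) \<partial>lborel)"
    using t by (intro nn_integral_cong) (auto simp: \<psi>_def indicator_def)
  also have "\<dots> = ennreal (Tail \<phi> t)"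
    unfolding Tail_def set_lebesgue_integral_def
    by (rule nn_integral_eq_integral[OF set_integrable_tail[OF t, unfolded set_integrable_def]])
       (use t in \<open>auto intro!: nonneg simp: indicator_def\<close>)
  finally show ?thesis .
qed

lemma nn_integral_origin:
  assumes r: "0 < r"
  shows "(\<integral>\<^sup>+s. ennreal (\<psi> s) * indicator {0<..<r} s \<partial>lborel) = \<infinity>"
proof (rule ccontr)
  assume "(\<integral>\<^sup>+s. ennreal (\<psi> s) * indicator {0<..<r} s \<partial>lborel) \<noteq> \<infinity>"
  moreover have "(\<integral>\<^sup>+s. ennreal (\<psi> s) * indicator {0<..<r} s \<partial>lborel) =
      (\<integral>\<^sup>+s. ennreal (indicator {0<..<r} s * \<psi> s) \<partial>lborel)"
    by (intro nn_integral_cong) (auto simp: indicator_def)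
  ultimately have "integrable lborel (\<lambda>s. indicator {0<..<r} s * \<psi> s)"
    by (intro integrableI_nonneg) (auto simp: \<psi>_nonneg less_top)
  then have "set_integrable lborel {0<..<r} \<phi>"
    unfolding set_integrable_def
    by (rule Bochner_Integration.integrable_cong[THEN iffD1, rotated 2])
       (auto simp: \<psi>_def indicator_def)
  then show False using not_integrable r by (auto simp: integrable_at_origin_def)
qed

lemma Tail_eq_measure:
  "0 < t \<Longrightarrow> emeasure (density lborel (\<lambda>r. ennreal (\<psi> r))) {t<..} = ennreal (Tail \<phi> t)"
  by (subst emeasure_density) (simp_all add: nn_integral_tail)

text \<open>Continuity from above along half-lines of finite measure that shrink to the empty
  set.\<close>

lemma Tail_small:
  assumes v: "0 < v"
  obtains t where "0 < t" "Tail \<phi> t < v"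
proof -
  let ?F = "density lborel (\<lambda>r. ennreal (\<psi> r))"
  have "(\<lambda>i. emeasure ?F {real (Suc i)<..}) \<longlonglongrightarrow> emeasure ?F (\<Inter>i. {real (Suc i)<..})"
    by (rule Lim_emeasure_decseq) (auto simp: decseq_def Tail_eq_measure simp del: of_nat_Suc)
  also have "(\<Inter>i. {real (Suc i)<..}) = {}"
  proof -
    have "\<exists>i. x \<le> real (Suc i)" for x
      using reals_Archimedean2[of x] by (metis le_less less_Suc_eq of_nat_less_iff order_less_trans)
    then show ?thesis by (auto simp: set_eq_iff simp flip: not_le simp del: of_nat_Suc)
  qed
  finally have "(\<lambda>i. emeasure ?F {real (Suc i)<..}) \<longlonglongrightarrow> 0" by simp
  then have "eventually (\<lambda>i. emeasure ?F {real (Suc i)<..} < ennreal v) sequentially"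
    by (rule order_tendstoD) (use v in simp)
  then obtain i where "emeasure ?F {real (Suc i)<..} < ennreal v"
    by (auto simp: eventually_sequentially simp del: of_nat_Suc)
  then have "Tail \<phi> (real (Suc i)) < v"
    by (subst (asm) Tail_eq_measure) (auto simp: ennreal_less_iff Tail_nonneg simp del: of_nat_Suc)
  then show ?thesis using that[of "real (Suc i)"] by (simp del: of_nat_Suc)
qed

text \<open>Continuity from below: the half-lines exhaust \<open>{0<..}\<close>, whose mass is
  infinite because \<open>\<phi>\<close> is not integrable at the origin.\<close>

lemma Tail_large:
  obtains t where "0 < t" "v < Tail \<phi> t"
proof -
  let ?F = "density lborel (\<lambda>r. ennreal (\<psi> r))"
  have "(\<lambda>i. emeasure ?F {1 / real (Suc i)<..}) \<longlonglongrightarrow> emeasure ?F (\<Union>i. {1 / real (Suc i)<..})"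
    by (rule Lim_emeasure_incseq) (auto simp: incseq_def frac_le le_less_trans simp del: of_nat_Suc)
  also have "(\<Union>i. {1 / real (Suc i)<..}) = {0<..}"
  proof -
    have "\<exists>i. 1 / real (Suc i) < x" if "0 < x" for x
      using nat_approx_posE[OF that] by metis
    moreover have "0 < x" if "1 / real (Suc i) < x" for x i
      using that by (rule less_trans[rotated]) simp
    ultimately show ?thesis by (auto simp del: of_nat_Suc)
  qed
  also have "emeasure ?F {0<..} = \<infinity>"
  proof -
    have "emeasure ?F {0<..<1} \<le> emeasure ?F {0<..}"
      by (intro emeasure_mono) auto
    moreover have "emeasure ?F {0<..<1} = \<infinity>"
      by (subst emeasure_density) (auto simp: nn_integral_origin)
    ultimately show ?thesis by (simp add: top_unique)
  qed
  finally have "(\<lambda>i. emeasure ?F {1 / real (Suc i)<..}) \<longlonglongrightarrow> \<infinity>" .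
  \<comment> \<open>\<open>v\<close> may be negative, and \<open>ennreal\<close> collapses negative
    reals to 0; \<open>\<bar>v\<bar>\<close> dominates \<open>v\<close> and transfers back
    faithfully.\<close>
  then have "eventually (\<lambda>i. ennreal \<bar>v\<bar> < emeasure ?F {1 / real (Suc i)<..}) sequentially"
    by (rule order_tendstoD) simp
  then obtain i where "ennreal \<bar>v\<bar> < emeasure ?F {1 / real (Suc i)<..}"
    by (auto simp: eventually_sequentially simp del: of_nat_Suc)
  then have "\<bar>v\<bar> < Tail \<phi> (1 / real (Suc i))"
    by (subst (asm) Tail_eq_measure) (auto simp: ennreal_less_iff simp del: of_nat_Suc)
  then show ?thesis using that[of "1 / real (Suc i)"] by simp
qed

text \<open>Intermediate value theorem. It lets a set of positive measure be compared with the
  complement of a ball of the same measure.\<close>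

lemma Tail_surj:
  assumes v: "0 < v"
  obtains t where "0 < t" "Tail \<phi> t = v"
proof -
  obtain a where a: "0 < a" "v < Tail \<phi> a" by (rule Tail_large)
  obtain b where b: "0 < b" "Tail \<phi> b < v" by (rule Tail_small[OF v])
  have "a \<le> b"
    using Tail_strict_antimono[of b a] a b by linarith
  then obtain t where "a \<le> t" "Tail \<phi> t = v"
    using IVT2'[of "Tail \<phi>" b v a, OF _ _ _ continuous_Tail[OF a(1)]] a b by auto
  then show ?thesis using that[of t] a by simp
qed

section \<open>Values of the isoperimetric profile\<close>

lemma iso_profile_Tail:
  assumes t: "0 < t"
  shows "iso_profile \<phi> (Tail \<phi> t) = \<phi> t"
  using Tail_pos[OF t] t
  by (simp add: iso_profile_def at_ext_def Tail_inv_def the_inv_into_f_f[OF inj_on_Tail])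

text \<open>The tail is positive on the whole half-line, so its support is unbounded; the inverse at
  0 is therefore \<open>\<infinity>\<close>, where \<open>at_ext\<close> gives 0.\<close>

lemma iso_profile_0: "iso_profile \<phi> 0 = 0"
proof -
  have "Sup (ereal ` {t. 0 < t \<and> Tail \<phi> t \<noteq> 0}) = \<infinity>"
  proof (rule ereal_top)
    fix B :: real
    have B: "0 < \<bar>B\<bar> + 1" by simp
    have "ereal B \<le> ereal (\<bar>B\<bar> + 1)" by simp
    also have "\<dots> \<le> Sup (ereal ` {t. 0 < t \<and> Tail \<phi> t \<noteq> 0})"
      using Tail_pos[OF B] B by (intro Sup_upper imageI) auto
    finally show "ereal B \<le> Sup (ereal ` {t. 0 < t \<and> Tail \<phi> t \<noteq> 0})" .
  qed
  then show ?thesis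
    by (simp add: iso_profile_def at_ext_def Tail_inv_def)
qed

end

section \<open>The isoperimetric inequality\<close>

context homogeneous_weight
begin

lemma nn_integral_weighted:
  assumes [measurable]: "g \<in> borel_measurable borel"
  shows "(\<integral>\<^sup>+x. g x \<partial>weighted) =
    (\<integral>\<^sup>+u. \<integral>\<^sup>+r. g (r *\<^sub>R u) \<partial>radial_measure DIM('a) \<partial>cone_measure)"
proof -
  interpret R: sigma_finite_measure "radial_measure DIM('a)" by (rule sigma_finite_radial_measure)
  have meas: "(\<lambda>x. (x /\<^sub>R N x, N x)) \<in> weighted \<rightarrow>\<^sub>M borel \<Otimes>\<^sub>M borel"
    unfolding weighted_def measurable_density_eq1 by (intro lebesgue_compose_borel) measurable
  have g: "(\<lambda>p. g (snd p *\<^sub>R fst p)) \<in> borel_measurable (borel \<Otimes>\<^sub>M borel)"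
    by measurable
  then have g': "(\<lambda>p. g (snd p *\<^sub>R fst p)) \<in> borel_measurable (cone_measure \<Otimes>\<^sub>M radial_measure DIM('a))"
    by (simp add: polar_decomposition)
  \<comment> \<open>This also holds at the origin, so no null set has to be removed.\<close>
  have "N x *\<^sub>R (x /\<^sub>R N x) = x" for x
    by (cases "x = 0") simp_all
  then have "(\<integral>\<^sup>+x. g x \<partial>weighted) = (\<integral>\<^sup>+x. g (snd (x /\<^sub>R N x, N x) *\<^sub>R fst (x /\<^sub>R N x, N x)) \<partial>weighted)"
    by (simp only: fst_conv snd_conv)
  also have "\<dots> = (\<integral>\<^sup>+p. g (snd p *\<^sub>R fst p) \<partial>distr weighted (borel \<Otimes>\<^sub>M borel) (\<lambda>x. (x /\<^sub>R N x, N x)))"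
    by (rule nn_integral_distr[OF meas, symmetric]) (use g in simp)
  also have "\<dots> = (\<integral>\<^sup>+p. g (snd p *\<^sub>R fst p) \<partial>(cone_measure \<Otimes>\<^sub>M radial_measure DIM('a)))"
    by (simp only: polar_decomposition)
  also have "\<dots> = (\<integral>\<^sup>+u. \<integral>\<^sup>+r. g (r *\<^sub>R u) \<partial>radial_measure DIM('a) \<partial>cone_measure)"
    using R.nn_integral_fst[OF g'] by simp
  finally show ?thesis .
qed

end

lemma scaled_unit_ball:
  assumes "nonsym_norm N" "0 < t"
  shows "(\<lambda>x. t *\<^sub>R x) ` unit_ball N = {x. N x < t}"
proof safe
  have hom: "N (r *\<^sub>R x) = r * N x" if "0 \<le> r" for r x
    using assms(1) that by (simp add: nonsym_norm_def)
  show "N (t *\<^sub>R x) < t" if "x \<in> unit_ball N" for x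
    using that assms(2) by (simp add: hom unit_ball_def)
  show "x \<in> (\<lambda>x. t *\<^sub>R x) ` unit_ball N" if "N x < t" for x
    using that assms(2)
    by (intro image_eqI[of _ _ "x /\<^sub>R t"]) (simp_all add: hom unit_ball_def field_simps)
qed

locale polar_density = homogeneous_weight N w + log_convex_density \<phi>
  for N w :: "'a::euclidean_space \<Rightarrow> real" and \<phi>
begin

section \<open>The measure in polar coordinates\<close>

abbreviation "\<mu> \<equiv> polar_measure N w \<phi>"
abbreviation "m \<equiv> sphere_mass N w"

text \<open>Homogeneity gives \<open>w (x /\<^sub>R N x) = w x / N x\<close>, so away from the
  origin the density is \<open>w x\<close> times a Borel function of \<open>N x\<close>.\<close>

lemma polar_measure_eq:
  assumes [measurable]: "B \<in> sets borel"
  shows "emeasure \<mu> B = (\<integral>\<^sup>+x. ennreal (\<psi> (N x) / N x ^ DIM('a)) * indicator B x \<partial>weighted)"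
proof -
  let ?n = "DIM('a)"
  let ?f = "\<lambda>x. ennreal (w (x /\<^sub>R N x) * N x powi (1 - int ?n) * \<phi> (N x))"
  define g where "g = (\<lambda>x. ennreal (\<psi> (N x) / N x ^ ?n))"
  have [measurable]: "g \<in> borel_measurable lebesgue"
    unfolding g_def by (rule lebesgue_compose_borel) measurable
  have B [measurable]: "B \<in> sets lebesgue" by simp
  have eq: "?f x = ennreal (w x) * g x" if "x \<noteq> 0" for x
  proof -
    have pos: "0 < N x" using that by simp
    have "w (x /\<^sub>R N x) * N x powi (1 - int ?n) * \<phi> (N x) = w x * (\<psi> (N x) / N x ^ ?n)"
      using pos by (simp add: w_scaleR power_int_diff \<psi>_pos field_simps)
    then show ?thesis
      by (simp only: g_def) (rule ennreal_mult, simp_all add: w_nonneg \<psi>_nonneg)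
  qed
  \<comment> \<open>Measurability of the given density is inherited from the product form, from
    which it differs at most at the origin.\<close>
  then have "?f = (\<lambda>x. if x = 0 then ?f 0 else ennreal (w x) * g x)"
    by auto
  also have "\<dots> \<in> borel_measurable lebesgue"
    by (rule measurable_If) (measurable, simp)
  finally have f: "?f \<in> borel_measurable lebesgue" .
  have "emeasure \<mu> B = (\<integral>\<^sup>+x. ?f x * indicator B x \<partial>lebesgue)"
    unfolding polar_measure_def by (rule emeasure_density[OF f B])
  also have "\<dots> = (\<integral>\<^sup>+x. ennreal (w x) * (g x * indicator B x) \<partial>lebesgue)"
    by (rule nn_integral_cong_AE, rule AE_mp[OF AE_lebesgue_nonzero], rule AE_I2, rule impI)
       (subst eq, assumption, simp only: mult.assoc)
  also have "\<dots> = (\<integral>\<^sup>+x. g x * indicator B x \<partial>weighted)"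
    unfolding weighted_def by (rule nn_integral_density[symmetric]) measurable
  finally show ?thesis unfolding g_def .
qed

text \<open>On the sphere \<open>N (r *\<^sub>R u) = r\<close> for positive \<open>r\<close>, and
  the radial factor \<open>r ^ DIM('a)\<close> cancels the denominator, leaving
  \<open>\<psi> r\<close> on every ray.\<close>

lemma emeasure_polar_measure:
  assumes [measurable]: "B \<in> sets borel"
  shows "emeasure \<mu> B =
    (\<integral>\<^sup>+u. \<integral>\<^sup>+r. ennreal (\<psi> r) * indicator B (r *\<^sub>R u) \<partial>lborel \<partial>cone_measure)"
proof -
  let ?n = "DIM('a)"
  have "emeasure \<mu> B = (\<integral>\<^sup>+u. \<integral>\<^sup>+r. ennreal (\<psi> (N (r *\<^sub>R u)) / N (r *\<^sub>R u) ^ ?n) * indicator B (r *\<^sub>R u)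
      \<partial>radial_measure ?n \<partial>cone_measure)"
    unfolding polar_measure_eq[OF assms] by (rule nn_integral_weighted) measurable
  also have "\<dots> = (\<integral>\<^sup>+u. \<integral>\<^sup>+r. ennreal (\<psi> r) * indicator B (r *\<^sub>R u) \<partial>lborel \<partial>cone_measure)"
  proof (rule nn_integral_cong_AE, rule AE_mp[OF AE_cone_measure], rule AE_I2, rule impI)
    fix u assume u: "N u = 1"
    have "(\<integral>\<^sup>+r. ennreal (\<psi> (N (r *\<^sub>R u)) / N (r *\<^sub>R u) ^ ?n) * indicator B (r *\<^sub>R u) \<partial>radial_measure ?n) =
      (\<integral>\<^sup>+r. ennreal (indicator {0<..} r * r ^ ?n) *
        (ennreal (\<psi> (N (r *\<^sub>R u)) / N (r *\<^sub>R u) ^ ?n) * indicator B (r *\<^sub>R u)) \<partial>lborel)"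
      unfolding radial_measure_def by (rule nn_integral_density) measurable
    also have "\<dots> = (\<integral>\<^sup>+r. ennreal (\<psi> r) * indicator B (r *\<^sub>R u) \<partial>lborel)"
    proof (rule nn_integral_cong)
      fix r :: real
      show "ennreal (indicator {0<..} r * r ^ ?n) *
        (ennreal (\<psi> (N (r *\<^sub>R u)) / N (r *\<^sub>R u) ^ ?n) * indicator B (r *\<^sub>R u)) =
        ennreal (\<psi> r) * indicator B (r *\<^sub>R u)"
      proof (cases "0 < r")
        case True
        have "ennreal (r ^ ?n) * ennreal (\<psi> r / r ^ ?n) = ennreal (\<psi> r)"
          using True by (subst ennreal_mult[symmetric]) (simp_all add: \<psi>_nonneg)
        then show ?thesis
          using True by (simp add: N_scaleR u mult.assoc[symmetric])
      qed (simp add: \<psi>_def)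
    qed
    finally show "(\<integral>\<^sup>+r. ennreal (\<psi> (N (r *\<^sub>R u)) / N (r *\<^sub>R u) ^ ?n) * indicator B (r *\<^sub>R u) \<partial>radial_measure ?n) =
      (\<integral>\<^sup>+r. ennreal (\<psi> r) * indicator B (r *\<^sub>R u) \<partial>lborel)" .
  qed
  finally show ?thesis .
qed

lemma sets_polar_measure [simp]: "sets \<mu> = sets lebesgue"
  by (simp add: polar_measure_def)

lemma complement_ball: "0 < t \<Longrightarrow> - ((\<lambda>x. t *\<^sub>R x) ` unit_ball N) = {x. t \<le> N x}"
  by (auto simp: scaled_unit_ball[OF norm])

lemma emeasure_complement_ball:
  assumes t: "0 < t"
  shows "emeasure \<mu> {x. t \<le> N x} = ennreal (m * Tail \<phi> t)"
proof -
  have "emeasure \<mu> {x. t \<le> N x} =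
      (\<integral>\<^sup>+u. \<integral>\<^sup>+r. ennreal (\<psi> r) * indicator {x. t \<le> N x} (r *\<^sub>R u) \<partial>lborel \<partial>cone_measure)"
    by (rule emeasure_polar_measure) measurable
  also have "\<dots> = (\<integral>\<^sup>+u. ennreal (Tail \<phi> t) \<partial>cone_measure)"
  proof (rule nn_integral_cong_AE, rule AE_mp[OF AE_cone_measure], rule AE_I2, rule impI)
    fix u assume u: "N u = 1"
    have "(\<integral>\<^sup>+r. ennreal (\<psi> r) * indicator {x. t \<le> N x} (r *\<^sub>R u) \<partial>lborel) =
        (\<integral>\<^sup>+r. ennreal (\<psi> r) * indicator {t<..} r \<partial>lborel)"
    \<comment> \<open>The complement of the open ball contains radius \<open>t\<close> while the
      tail starts strictly after it; one radius is null.\<close>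
    proof (rule nn_integral_cong_AE, rule AE_mp[OF AE_lborel_singleton[of t]], rule AE_I2, rule impI)
      fix r assume "r \<noteq> t"
      then show "ennreal (\<psi> r) * indicator {x. t \<le> N x} (r *\<^sub>R u) = ennreal (\<psi> r) * indicator {t<..} r"
        using t u by (cases "0 < r") (auto simp: N_scaleR \<psi>_def indicator_def)
    qed
    then show "(\<integral>\<^sup>+r. ennreal (\<psi> r) * indicator {x. t \<le> N x} (r *\<^sub>R u) \<partial>lborel) = ennreal (Tail \<phi> t)"
      by (simp add: nn_integral_tail[OF t])
  qed
  also have "\<dots> = ennreal (m * Tail \<phi> t)"
    using Tail_nonneg[OF t]
    by (simp add: emeasure_cone_measure_UNIV ennreal_mult sphere_mass_nonneg mult.commute)
  finally show ?thesis .
qed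

text \<open>The bathtub principle: since \<open>\<phi> (r + d) / \<phi> r\<close> is nondecreasing in \<open>r\<close>, among all sets of
  given measure the complement of a ball carries the largest integral of this ratio.\<close>

lemma shifted_integral_le:
  assumes [measurable]: "C \<in> sets borel" and t: "0 < t" and d: "0 < d"
    and C: "emeasure \<mu> C = ennreal (m * Tail \<phi> t)"
  shows "(\<integral>\<^sup>+u. \<integral>\<^sup>+r. ennreal (\<psi> r) * indicator {d<..} r * indicator C ((r - d) *\<^sub>R u) \<partial>lborel \<partial>cone_measure)
    \<le> ennreal (m * Tail \<phi> (t + d))"
proof -
  \<comment> \<open>The threshold of the bathtub argument: the value at \<open>r = t\<close> of the
    ratio \<open>\<phi> (r + d) / \<phi> r\<close>.\<close>
  define c where "c = ennreal (\<phi> (t + d) / \<phi> t)"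
  let ?X = "\<lambda>u. \<integral>\<^sup>+r. ennreal (\<psi> r) * indicator {d<..} r * indicator C ((r - d) *\<^sub>R u) \<partial>lborel"
  let ?C = "\<lambda>u. \<integral>\<^sup>+r. ennreal (\<psi> r) * indicator C (r *\<^sub>R u) \<partial>lborel"
  have \<phi>t: "0 < \<phi> t" "0 < \<phi> (t + d)" using t d by (auto intro: pos)
  \<comment> \<open>Since \<open>\<phi> (r + d) - c * \<phi> r\<close> changes sign from nonpositive
    to nonnegative at \<open>t\<close>, its integral over \<open>r > t\<close> dominates that over
    any slice of \<open>C\<close>. The terms are arranged to avoid subtraction in
    \<open>ennreal\<close>. The threshold is the same on all rays, so individual slices need not
    have mass \<open>Tail \<phi> t\<close>.\<close>
  have X: "?X u + c * ennreal (Tail \<phi> t) \<le> ennreal (Tail \<phi> (t + d)) + c * ?C u" for u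
  proof -
    have shift: "?X u = (\<integral>\<^sup>+r. ennreal (\<psi> (d + r)) * indicator {0<..} r * indicator C (r *\<^sub>R u) \<partial>lborel)"
      by (subst nn_integral_real_affine[where c=1 and t=d]) (measurable, simp add: indicator_def)
    have shift_tail: "ennreal (Tail \<phi> (t + d)) = (\<integral>\<^sup>+r. ennreal (\<psi> (d + r)) * indicator {t<..} r \<partial>lborel)"
      using t d by (subst nn_integral_tail[symmetric], simp,
        subst nn_integral_real_affine[where c=1 and t=d]) (auto simp: indicator_def)
    have le: "ennreal (\<psi> (d + r)) * indicator {0<..} r * indicator C (r *\<^sub>R u) + c * (ennreal (\<psi> r) * indicator {t<..} r)
      \<le> ennreal (\<psi> (d + r)) * indicator {t<..} r + c * (ennreal (\<psi> r) * indicator C (r *\<^sub>R u))" for r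
    proof (cases "0 < r")
      case True
      have c: "c * ennreal (\<psi> r) = ennreal (\<phi> (t + d) / \<phi> t * \<phi> r)"
        using True \<phi>t pos[OF True] unfolding c_def \<psi>_pos[OF True]
        by (intro ennreal_mult[symmetric]) simp_all
      have \<psi>: "\<psi> (d + r) = \<phi> (r + d)" using True d by (simp add: \<psi>_pos add.commute)
      have "\<phi> (t + d) / \<phi> t * \<phi> r \<le> \<phi> (r + d)" if "t < r"
        using shift_ratio_mono[of t r d] that t d \<phi>t by (simp add: field_simps)
      moreover have "\<phi> (r + d) \<le> \<phi> (t + d) / \<phi> t * \<phi> r" if "r \<le> t"
        using shift_ratio_mono[of r t d] that True d \<phi>t by (simp add: field_simps)
      ultimately show ?thesis
        using True unfolding mult.assoc[symmetric] c \<psi>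
        by (auto simp: indicator_def not_less intro: ennreal_leI simp: add.commute)
    next
      case False
      then show ?thesis using t by (simp add: \<psi>_def)
    qed
    have "?X u + c * ennreal (Tail \<phi> t) =
      (\<integral>\<^sup>+r. ennreal (\<psi> (d + r)) * indicator {0<..} r * indicator C (r *\<^sub>R u) + c * (ennreal (\<psi> r) * indicator {t<..} r) \<partial>lborel)"
      by (subst nn_integral_add) (measurable, simp add: shift nn_integral_tail[OF t] nn_integral_cmult)
    also have "\<dots> \<le> (\<integral>\<^sup>+r. ennreal (\<psi> (d + r)) * indicator {t<..} r + c * (ennreal (\<psi> r) * indicator C (r *\<^sub>R u)) \<partial>lborel)"
      by (intro nn_integral_mono le)
    also have "\<dots> = ennreal (Tail \<phi> (t + d)) + c * ?C u"
      by (subst nn_integral_add) (measurable, simp add: shift_tail nn_integral_cmult)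
    finally show ?thesis .
  qed
  have [measurable]: "?X \<in> borel_measurable cone_measure" "?C \<in> borel_measurable cone_measure"
    by measurable
  have const: "(\<integral>\<^sup>+u. ennreal v \<partial>cone_measure) = ennreal (m * v)" if "0 \<le> v" for v
    using that by (simp add: emeasure_cone_measure_UNIV ennreal_mult sphere_mass_nonneg mult.commute)
  have "(\<integral>\<^sup>+u. ?X u \<partial>cone_measure) + c * ennreal (m * Tail \<phi> t) =
      (\<integral>\<^sup>+u. ?X u + c * ennreal (Tail \<phi> t) \<partial>cone_measure)"
    using Tail_nonneg[OF t]
    by (simp add: nn_integral_add nn_integral_cmult const[symmetric] mult.assoc)
  also have "\<dots> \<le> (\<integral>\<^sup>+u. ennreal (Tail \<phi> (t + d)) + c * ?C u \<partial>cone_measure)"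
    by (intro nn_integral_mono X)
  also have "\<dots> = ennreal (m * Tail \<phi> (t + d)) + c * emeasure \<mu> C"
    using Tail_nonneg[of "t + d"] t d
    by (simp add: nn_integral_add nn_integral_cmult const[symmetric] emeasure_polar_measure)
  \<comment> \<open>Only here does the prescribed measure of \<open>C\<close> enter: it equalizes
    the two multiplier terms, which are finite and so cancel.\<close>
  finally have "(\<integral>\<^sup>+u. ?X u \<partial>cone_measure) + c * ennreal (m * Tail \<phi> t) \<le>
      ennreal (m * Tail \<phi> (t + d)) + c * ennreal (m * Tail \<phi> t)"
    by (simp only: C)
  moreover have "c * ennreal (m * Tail \<phi> t) \<noteq> top"
    by (simp add: c_def ennreal_mult_eq_top_iff)
  ultimately show ?thesis
    by (simp add: ennreal_add_left_cancel_le add.commute)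
qed

text \<open>Non-integrability of \<open>\<phi>\<close> at the origin gives every neighbourhood of the origin infinite measure.\<close>

lemma meets_complement:
  assumes C: "C \<in> sets borel" "emeasure \<mu> C < \<infinity>" and m: "0 < m"
    and U: "open U" "0 \<in> U"
  obtains a where "a \<in> U" "a \<notin> C"
proof (rule ccontr)
  assume "\<not> thesis"
  then have sub: "U \<subseteq> C" using that by blast
  have UB [measurable]: "U \<in> sets borel" using U by simp
  have "(\<integral>\<^sup>+r. ennreal (\<psi> r) * indicator U (r *\<^sub>R u) \<partial>lborel) = \<infinity>" for u
  proof -
    \<comment> \<open>Every ray meets \<open>U\<close> in at least an initial segment, which has
      infinite radial mass.\<close>
    have "open ((\<lambda>r. r *\<^sub>R u) -` U)"
      by (intro open_vimage U continuous_intros)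
    then obtain \<rho> where \<rho>: "0 < \<rho>" "ball 0 \<rho> \<subseteq> (\<lambda>r. r *\<^sub>R u) -` U"
      by (rule openE[of _ 0]) (use U(2) in simp)
    have "\<infinity> = (\<integral>\<^sup>+r. ennreal (\<psi> r) * indicator {0<..<\<rho>} r \<partial>lborel)"
      using nn_integral_origin[OF \<rho>(1)] by simp
    also have "\<dots> \<le> (\<integral>\<^sup>+r. ennreal (\<psi> r) * indicator U (r *\<^sub>R u) \<partial>lborel)"
      using \<rho>(2) by (intro nn_integral_mono mult_left_mono) (auto simp: indicator_def subset_eq)
    finally show ?thesis by (simp add: top_unique)
  qed
  then have "emeasure \<mu> U = \<infinity>"
    using m by (simp add: emeasure_polar_measure[OF UB] emeasure_cone_measure_UNIV ennreal_top_mult)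
  moreover have "emeasure \<mu> U \<le> emeasure \<mu> C"
    using sub C by (intro emeasure_mono) simp_all
  ultimately show False using C(2) by (simp add: top_unique)
qed

section \<open>Lower bound for the boundary measure\<close>

text \<open>A union of translates of an open set, hence Borel for arbitrary
  \<open>A\<close>.\<close>

lemma open_minkowski_sum_ball:
  "open (minkowski_sum A {x. N x < e})"
proof -
  have eq: "minkowski_sum A {x. N x < e} = (\<Union>a\<in>A. {x. N (x - a) < e})"
    unfolding minkowski_sum_def by (force intro: exI[of _ "_ - _"])
  show ?thesis
    unfolding eq
    by (intro open_UN ballI open_Collect_less continuous_on_const
        continuous_on_compose2[OF continuous_N[of UNIV]] continuous_intros) auto
qed

text \<open>The part of \<open>C\<close> that survives the enlargement stays in \<open>C\<close>
  when pulled inward by any \<open>d < e\<close>, so \<open>shifted_integral_le\<close> bounds it by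
  \<open>m * Tail \<phi> (t + d)\<close>; the rest of \<open>C\<close> was swallowed.\<close>

lemma expansion_lower_bound:
  assumes C [measurable]: "C \<in> sets borel" and m: "0 < m" and t: "0 < t" and e: "0 < e"
    and \<mu>C: "emeasure \<mu> C = ennreal (m * Tail \<phi> t)"
  shows "ennreal (e * (m * \<phi> (t + e))) \<le> emeasure \<mu> (minkowski_sum (- C) {x. N x < e} - (- C))"
proof -
  define A where "A = minkowski_sum (- C) {x. N x < e}"
  have A [measurable]: "A \<in> sets borel"
    unfolding A_def by (rule borel_open[OF open_minkowski_sum_ball])
  have fin: "emeasure \<mu> C < \<infinity>" by (simp add: \<mu>C)
  have AI: "a + b \<in> A" if "a \<notin> C" "N b < e" for a b
    using that by (auto simp: A_def minkowski_sum_def)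
  have upper: "emeasure \<mu> (C - A) \<le> ennreal (m * Tail \<phi> (t + d))" if d: "0 < d" "d < e" for d
  proof -
    have "emeasure \<mu> (C - A) =
        (\<integral>\<^sup>+u. \<integral>\<^sup>+r. ennreal (\<psi> r) * indicator (C - A) (r *\<^sub>R u) \<partial>lborel \<partial>cone_measure)"
      by (rule emeasure_polar_measure) measurable
    also have "\<dots> \<le> (\<integral>\<^sup>+u. \<integral>\<^sup>+r. ennreal (\<psi> r) * indicator {d<..} r * indicator C ((r - d) *\<^sub>R u)
        \<partial>lborel \<partial>cone_measure)"
    proof (rule nn_integral_mono_AE, rule AE_mp[OF AE_cone_measure], rule AE_I2, rule impI)
      fix u assume u: "N u = 1"
      have *: "d < r" "(r - d) *\<^sub>R u \<in> C" if r: "0 < r" "r *\<^sub>R u \<notin> A" for r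
      proof -
        show "d < r"
        proof (rule ccontr)
          assume "\<not> d < r"
          then have "N (r *\<^sub>R u) < e" using r d by (simp add: N_scaleR u)
          \<comment> \<open>This open set contains the origin because \<open>r \<le> d < e\<close>,
            so it meets the complement of \<open>C\<close>, which would put
            \<open>r *\<^sub>R u\<close> into \<open>A\<close>.\<close>
          moreover have "open {a. N (r *\<^sub>R u - a) < e}"
            by (intro open_Collect_less continuous_on_const
              continuous_on_compose2[OF continuous_N[of UNIV]] continuous_intros) auto
          ultimately obtain a where "N (r *\<^sub>R u - a) < e" "a \<notin> C"
            using meets_complement[OF C fin m, of "{a. N (r *\<^sub>R u - a) < e}"] by auto
          then show False using AI[of a "r *\<^sub>R u - a"] r by simp
        qed
        show "(r - d) *\<^sub>R u \<in> C"
        proof (rule ccontr)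
          assume "(r - d) *\<^sub>R u \<notin> C"
          then have "(r - d) *\<^sub>R u + d *\<^sub>R u \<in> A"
            by (rule AI) (use d in \<open>simp add: N_scaleR u\<close>)
          then show False using r by (simp add: algebra_simps)
        qed
      qed
      show "(\<integral>\<^sup>+r. ennreal (\<psi> r) * indicator (C - A) (r *\<^sub>R u) \<partial>lborel) \<le>
        (\<integral>\<^sup>+r. ennreal (\<psi> r) * indicator {d<..} r * indicator C ((r - d) *\<^sub>R u) \<partial>lborel)"
      proof (rule nn_integral_mono)
        fix r :: real
        show "ennreal (\<psi> r) * indicator (C - A) (r *\<^sub>R u) \<le>
          ennreal (\<psi> r) * indicator {d<..} r * indicator C ((r - d) *\<^sub>R u)"
          using *[of r] by (cases "0 < r") (auto simp: indicator_def \<psi>_def)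
      qed
    qed
    also have "\<dots> \<le> ennreal (m * Tail \<phi> (t + d))"
      by (rule shifted_integral_le[OF C t d(1) \<mu>C])
    finally show ?thesis .
  qed
  have CA: "emeasure \<mu> (C - A) < \<infinity>" "emeasure \<mu> (C \<inter> A) < \<infinity>"
    using fin by (auto intro!: le_less_trans[OF emeasure_mono[of _ C]])
  have split: "emeasure \<mu> (C \<inter> A) + emeasure \<mu> (C - A) = ennreal (m * Tail \<phi> t)"
  proof -
    have "emeasure \<mu> (C \<inter> A) + emeasure \<mu> (C - A) = emeasure \<mu> (C \<inter> A \<union> (C - A))"
      by (rule plus_emeasure) auto
    also have "C \<inter> A \<union> (C - A) = C" by auto
    finally show ?thesis by (simp only: \<mu>C)
  qed
  define M where "M = measure \<mu> (C \<inter> A)"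
  have M: "emeasure \<mu> (C \<inter> A) = ennreal M"
    using CA(2) by (simp add: M_def emeasure_eq_ennreal_measure)
  have real_split: "M + measure \<mu> (C - A) = m * Tail \<phi> t"
  proof -
    have "ennreal (M + measure \<mu> (C - A)) = ennreal (m * Tail \<phi> t)"
      using split CA M by (simp add: emeasure_eq_ennreal_measure M_def)
    then show ?thesis
      using m Tail_nonneg[OF t] by (subst (asm) ennreal_inj) (auto simp: M_def)
  qed
  have step: "d * (m * \<phi> (t + e)) \<le> M" if d: "0 < d" "d < e" for d
  proof -
    have "measure \<mu> (C - A) \<le> m * Tail \<phi> (t + d)"
      using upper[OF d] CA(1) m Tail_nonneg[of "t + d"] t d
      by (simp add: emeasure_eq_ennreal_measure)
    \<comment> \<open>Replacing \<open>\<phi> (t + d)\<close> by the smaller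
      \<open>\<phi> (t + e)\<close> leaves a bound linear in \<open>d\<close>.\<close>
    moreover have "d * \<phi> (t + e) \<le> d * \<phi> (t + d)"
      using t d by (intro mult_left_mono le) auto
    then have "d * \<phi> (t + e) \<le> Tail \<phi> t - Tail \<phi> (t + d)"
      using Tail_diff(1)[OF t, of d] d by linarith
    then have "m * (d * \<phi> (t + e)) \<le> m * (Tail \<phi> t - Tail \<phi> (t + d))"
      using m by (intro mult_left_mono) auto
    ultimately show ?thesis using real_split by (simp add: algebra_simps)
  qed
  have "e * (m * \<phi> (t + e)) \<le> M"
  \<comment> \<open>The ball is open, so only \<open>d < e\<close> was available;
    \<open>d = z * e\<close> with \<open>z\<close> tending to 1 recovers \<open>e\<close>.\<close>
  proof (rule field_le_mult_one_interval)
    fix z :: real assume z: "0 < z" "z < 1"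
    show "z * (e * (m * \<phi> (t + e))) \<le> M"
      using step[of "z * e"] z e by (simp add: mult.assoc)
  qed
  then have "ennreal (e * (m * \<phi> (t + e))) \<le> emeasure \<mu> (C \<inter> A)"
    by (simp add: M ennreal_leI)
  also have "C \<inter> A = A - (- C)" by auto
  finally show ?thesis by (simp add: A_def)
qed

lemma inner_boundary_measure_eq:
  "inner_boundary_measure N \<mu> C =
    Liminf (at_right 0) (\<lambda>e. emeasure \<mu> (minkowski_sum (- C) {x. N x < e} - (- C)) / ennreal e)"
  unfolding inner_boundary_measure_def
  by (intro Liminf_eq eventually_at_rightI[of 0 1]) (auto simp: scaled_unit_ball[OF norm])

text \<open>Divide the expansion bound by \<open>e\<close>; continuity of \<open>\<phi>\<close> at
  \<open>t\<close> identifies the limit.\<close>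

lemma inner_boundary_measure_lower_bound:
  assumes C: "C \<in> sets borel" and m: "0 < m" and t: "0 < t"
    and \<mu>C: "emeasure \<mu> C = ennreal (m * Tail \<phi> t)"
  shows "ennreal (m * \<phi> t) \<le> inner_boundary_measure N \<mu> C"
proof -
  have "isCont \<phi> t"
    using continuous_on_interior[OF continuous, of t] t by (simp add: interior_open)
  then have "((\<lambda>e. \<phi> (t + e)) \<longlongrightarrow> \<phi> t) (at_right 0)"
    by (intro isCont_tendsto_compose[of _ \<phi>] tendsto_eq_intros | simp)+
  then have "((\<lambda>e. ennreal (m * \<phi> (t + e))) \<longlongrightarrow> ennreal (m * \<phi> t)) (at_right 0)"
    by (intro tendsto_ennrealI tendsto_mult_left)
  then have "ennreal (m * \<phi> t) = Liminf (at_right 0) (\<lambda>e. ennreal (m * \<phi> (t + e)))"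
    by (intro lim_imp_Liminf[symmetric]) simp_all
  also have "\<dots> \<le> inner_boundary_measure N \<mu> C"
    unfolding inner_boundary_measure_eq
  proof (intro Liminf_mono eventually_at_rightI[of 0 1])
    fix e :: real assume "e \<in> {0<..<1}"
    then have e: "0 < e" by simp
    have "ennreal (m * \<phi> (t + e)) = ennreal (e * (m * \<phi> (t + e))) / ennreal e"
      using e m t nonneg[of "t + e"] by (subst divide_ennreal) auto
    also have "\<dots> \<le> emeasure \<mu> (minkowski_sum (- C) {x. N x < e} - (- C)) / ennreal e"
      by (intro divide_right_mono_ennreal expansion_lower_bound[OF C m t e \<mu>C])
    finally show "ennreal (m * \<phi> (t + e)) \<le>
      emeasure \<mu> (minkowski_sum (- C) {x. N x < e} - (- C)) / ennreal e" .
  qed simp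
  finally show ?thesis .
qed

lemma isoperimetric_inequality:
  assumes C: "C \<in> sets borel" and fin: "emeasure \<mu> C < \<infinity>"
  shows "ennreal (m * iso_profile \<phi> (measure \<mu> C / m)) \<le> inner_boundary_measure N \<mu> C"
proof (cases "0 < m \<and> 0 < measure \<mu> C")
  case True
  then have "0 < measure \<mu> C / m" by simp
  then obtain t where t: "0 < t" "Tail \<phi> t = measure \<mu> C / m" by (rule Tail_surj)
  have "emeasure \<mu> C = ennreal (m * Tail \<phi> t)"
    using fin True by (simp add: t emeasure_eq_ennreal_measure)
  then show ?thesis
    using inner_boundary_measure_lower_bound[OF C _ t(1)] True
    by (simp add: t(2)[symmetric] iso_profile_Tail[OF t(1)])
next
  case False
  \<comment> \<open>In either case the claimed bound is 0, by the factor \<open>m\<close> or by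
    \<open>iso_profile_0\<close>.\<close>
  then have "m = 0 \<or> measure \<mu> C = 0"
    using sphere_mass_nonneg measure_nonneg[of \<mu> C] by linarith
  then show ?thesis by (auto simp: iso_profile_0)
qed

section \<open>Equality for complements of balls\<close>

lemma complement_ball_borel: "{x. t \<le> N x} \<in> sets borel"
  by measurable

text \<open>The triangle inequality confines the enlarged ball to radius \<open>t + e\<close>, so
  the gain is at most a tail difference and the quotient at most \<open>m * \<phi> t\<close>. The
  general lower bound gives the converse.\<close>

lemma inner_boundary_measure_complement_ball:
  assumes t: "0 < t"
  shows "inner_boundary_measure N \<mu> {x. t \<le> N x} = ennreal (m * \<phi> t)"
proof (rule antisym)
  have "inner_boundary_measure N \<mu> {x. t \<le> N x} \<le> Liminf (at_right 0) (\<lambda>_::real. ennreal (m * \<phi> t))"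
    unfolding inner_boundary_measure_eq
  proof (intro Liminf_mono eventually_at_rightI[of 0 1])
    fix e :: real assume "e \<in> {0<..<1}"
    then have e: "0 < e" by simp
    have sub: "minkowski_sum (- {x. t \<le> N x}) {x. N x < e} - (- {x. t \<le> N x}) \<subseteq>
        {x. t \<le> N x} - {x. t + e \<le> N x}"
    proof -
      have "N (a + b) < t + e" if "N a < t" "N b < e" for a b
        using N_triangle[of a b] that by simp
      then show ?thesis by (force simp: minkowski_sum_def not_le)
    qed
    have "emeasure \<mu> (minkowski_sum (- {x. t \<le> N x}) {x. N x < e} - (- {x. t \<le> N x})) \<le>
        emeasure \<mu> ({x. t \<le> N x} - {x. t + e \<le> N x})"
      using complement_ball_borel by (intro emeasure_mono[OF sub]) simp
    also have "\<dots> = emeasure \<mu> {x. t \<le> N x} - emeasure \<mu> {x. t + e \<le> N x}"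
      using complement_ball_borel t e
      by (intro emeasure_Diff) (auto simp: emeasure_complement_ball)
    also have "\<dots> = ennreal (m * Tail \<phi> t - m * Tail \<phi> (t + e))"
      using t e Tail_nonneg[of "t + e"] sphere_mass_nonneg
      by (simp add: emeasure_complement_ball ennreal_minus)
    also have "\<dots> \<le> ennreal (e * (m * \<phi> t))"
    proof (rule ennreal_leI)
      have "m * (Tail \<phi> t - Tail \<phi> (t + e)) \<le> m * (e * \<phi> t)"
        using Tail_diff(2)[OF t, of e] e sphere_mass_nonneg by (intro mult_left_mono) auto
      then show "m * Tail \<phi> t - m * Tail \<phi> (t + e) \<le> e * (m * \<phi> t)"
        by (simp add: algebra_simps)
    qed
    finally have "emeasure \<mu> (minkowski_sum (- {x. t \<le> N x}) {x. N x < e} - (- {x. t \<le> N x})) / ennreal e \<le>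
        ennreal (e * (m * \<phi> t)) / ennreal e"
      by (rule divide_right_mono_ennreal)
    also have "\<dots> = ennreal (m * \<phi> t)"
      using e t nonneg[of t] sphere_mass_nonneg by (subst divide_ennreal) auto
    finally show "emeasure \<mu> (minkowski_sum (- {x. t \<le> N x}) {x. N x < e} - (- {x. t \<le> N x})) / ennreal e
      \<le> ennreal (m * \<phi> t)" .
  qed simp
  then show "inner_boundary_measure N \<mu> {x. t \<le> N x} \<le> ennreal (m * \<phi> t)"
    by (simp add: Liminf_const)
  show "ennreal (m * \<phi> t) \<le> inner_boundary_measure N \<mu> {x. t \<le> N x}"
  proof (cases "m = 0")
    case False
    then have "0 < m" using sphere_mass_nonneg by simp
    then show ?thesis
      by (intro inner_boundary_measure_lower_bound[OF complement_ball_borel _ t] emeasure_complement_ball t)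
  qed simp
qed

lemma complement_ball_equality:
  assumes t: "0 < t"
  shows "inner_boundary_measure N \<mu> {x. t \<le> N x} =
    ennreal (m * iso_profile \<phi> (measure \<mu> {x. t \<le> N x} / m))"
proof (cases "m = 0")
  case False
  have "measure \<mu> {x. t \<le> N x} = m * Tail \<phi> t"
    using emeasure_complement_ball[OF t] sphere_mass_nonneg Tail_nonneg[OF t]
    by (simp add: measure_def)
  then show ?thesis
    using False t by (simp add: inner_boundary_measure_complement_ball iso_profile_Tail)
qed (simp add: inner_boundary_measure_complement_ball[OF t])

text \<open>The lower bound depends on a set only through its measure, and the complement of a ball
  attains it.\<close>

lemma complement_ball_minimizer:
  assumes t: "0 < t"
  shows "isoperimetric_minimizer N \<mu> {x. t \<le> N x}"
  unfolding isoperimetric_minimizer_def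
proof (intro conjI ballI impI)
  show fin: "emeasure \<mu> {x. t \<le> N x} < \<infinity>" by (simp add: emeasure_complement_ball[OF t])
  fix D assume D: "D \<in> sets borel" "emeasure \<mu> D = emeasure \<mu> {x. t \<le> N x}"
  then have "measure \<mu> D = measure \<mu> {x. t \<le> N x}" by (simp add: measure_def)
  then show "inner_boundary_measure N \<mu> {x. t \<le> N x} \<le> inner_boundary_measure N \<mu> D"
    using isoperimetric_inequality[OF D(1)] D(2) fin
    by (simp add: complement_ball_equality[OF t])
qed (rule complement_ball_borel)

end

text \<open>Measure \<open>m * Tail \<phi> t\<close> is paired with boundary measure
  \<open>m * \<phi> t\<close>, so the profile for mass \<open>m\<close> is the rescaling
  \<open>m * I (v / m)\<close>, which becomes \<open>I\<close> itself when
  \<open>m = 1\<close>.\<close>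

theorem theorem1p4:
  fixes N w\<^sub>0 :: "real ^ 'n \<Rightarrow> real" and \<phi> :: "real \<Rightarrow> real"
  assumes "nonsym_norm N"
    and "\<forall>x. 0 \<le> w\<^sub>0 x"
    and "one_homogeneous w\<^sub>0"
    and "w\<^sub>0 \<in> borel_measurable lebesgue"
    and "(\<integral>\<^sup>+x\<in>unit_ball N. ennreal (w\<^sub>0 x) \<partial>lebesgue) < \<infinity>"
    and "\<forall>t>0. 0 \<le> \<phi> t"
    and "antimono_on {0<..} \<phi>"
    and "\<not> integrable_at_origin \<phi>"
    and "integrable_at_infinity \<phi>"
    and "log_convex_pos \<phi>"
  shows "let \<mu> = polar_measure N w\<^sub>0 \<phi>;
             m = sphere_mass N w\<^sub>0;
             I = iso_profile \<phi>;
             E = (\<lambda>t. - ((\<lambda>x. t *\<^sub>R x) ` unit_ball N))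
         in (\<forall>C\<in>sets borel. emeasure \<mu> C < \<infinity> \<longrightarrow>
               inner_boundary_measure N \<mu> C \<ge> ennreal (m * I (measure \<mu> C / m))) \<and>
            (\<forall>t>0. E t \<in> sets borel \<and> emeasure \<mu> (E t) < \<infinity> \<and>
               inner_boundary_measure N \<mu> (E t) = ennreal (m * I (measure \<mu> (E t) / m))) \<and>
            (\<forall>t>0. isoperimetric_minimizer N \<mu> (E t)) \<and>
            (m = 1 \<longrightarrow>
               (\<forall>C\<in>sets borel. emeasure \<mu> C < \<infinity> \<longrightarrow>
                  inner_boundary_measure N \<mu> C \<ge> ennreal (I (measure \<mu> C))) \<and>
               (\<forall>t>0. inner_boundary_measure N \<mu> (E t) = ennreal (I (measure \<mu> (E t)))))"
proof -
  interpret polar_density N w\<^sub>0 \<phi>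
    using assms by unfold_locales auto
  show ?thesis
    unfolding Let_def
    using isoperimetric_inequality complement_ball_equality complement_ball_minimizer
      complement_ball_borel emeasure_complement_ball
    by (auto simp: complement_ball)
qed

end
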